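(* For every integer $m\geq1$ there exist a $b^m$-symplectic manifold $(W,\omega)$ with non-empty critical hypersurface $Z$ and a proper smooth function $H:W\to\mathbb{R}$ such that the flow of the Hamiltonian vector field $X_H$ has no periodic orbits on $W\setminus Z$.
   Context: Manifolds here are without boundary. Let $W$ be a manifold with a hypersurface $Z=z^{-1}(0)$, where $z:W\to\mathbb{R}$ is a global defining function ($dz\neq0$ along $Z$). A $b^m$-vector field is a smooth vector field $v$ with $v(z)\in z^mC^\infty(W)$. These are the sections of a vector bundle ${}^{b^m}TW$, locally spanned by $z^m\partial_z$ and the coordinate fields along $Z$. A $b^m$-form of degree $k$ is a section of $\Lambda^k({}^{b^m}TW)^*$; it can be written $\frac{dz}{z^m}\wedge\eta+\beta$ with $\eta,\beta$ smooth forms. The exterior derivative is the extension of the usual one on $W\setminus Z$. A $b^m$-symplectic form on $W^{2n}$ is a $b^m$-form $\omega$ of degree 2 with $d\omega=0$ and $\omega^n\neq0$ everywhere as a section of $\Lambda^{2n}({}^{b^m}TW)^*$; $Z$ is called the critical hypersurface. The Hamiltonian vector field of $H\in C^\infty(W)$ is the $b^m$-vector field $X_H$ determined by $\iota_{X_H}\omega=-dH$ (the sign convention is irrelevant here). A periodic orbit is an integral curve $\gamma$ with $\gamma(t+T)=\gamma(t)$ for all $t$, for some $T>0$. *)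

theory Defs
  imports "HOL-Analysis.Analysis"
begin

section \<open>Smooth functions on open subsets of \<open>\<real>\<^sup>d\<close>\<close>

text \<open>\<open>\<real>\<^sup>d\<close> is \<^term>\<open>Euclidean_space d\<close>: the sequences vanishing from index \<open>d\<close> on.\<close>

definition partial_deriv :: "nat \<Rightarrow> ((nat \<Rightarrow> real) \<Rightarrow> real) \<Rightarrow> (nat \<Rightarrow> real) \<Rightarrow> real" where
  "partial_deriv i f x = deriv (\<lambda>t. f (x(i := t))) (x i)"

primrec Ck_on :: "nat \<Rightarrow> nat \<Rightarrow> (nat \<Rightarrow> real) set \<Rightarrow> ((nat \<Rightarrow> real) \<Rightarrow> real) \<Rightarrow> bool" where
  "Ck_on 0 d U f \<longleftrightarrow>
     continuous_map (subtopology (Euclidean_space d) U) euclideanreal f"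
| "Ck_on (Suc k) d U f \<longleftrightarrow>
     continuous_map (subtopology (Euclidean_space d) U) euclideanreal f \<and>
     (\<forall>i<d. (\<forall>x\<in>U. (\<lambda>t. f (x(i := t))) differentiable (at (x i))) \<and>
            Ck_on k d U (partial_deriv i f))"

definition smooth_on :: "nat \<Rightarrow> (nat \<Rightarrow> real) set \<Rightarrow> ((nat \<Rightarrow> real) \<Rightarrow> real) \<Rightarrow> bool" where
  "smooth_on d U f \<longleftrightarrow> (\<forall>k. Ck_on k d U f)"

section \<open>Smooth manifolds without boundary\<close>

record 'a manifold =
  mdim :: nat
  mtop :: "'a topology"
  charts :: "('a set \<times> ('a \<Rightarrow> nat \<Rightarrow> real)) set"

abbreviation points :: "'a manifold \<Rightarrow> 'a set" where
  "points M \<equiv> topspace (mtop M)"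

definition smooth_manifold :: "'a manifold \<Rightarrow> bool" where
  "smooth_manifold M \<longleftrightarrow>
     Hausdorff_space (mtop M) \<and> second_countable (mtop M) \<and>
     \<Union> (fst ` charts M) = points M \<and>
     (\<forall>(U, \<phi>) \<in> charts M.
        openin (mtop M) U \<and> openin (Euclidean_space (mdim M)) (\<phi> ` U) \<and>
        homeomorphic_map (subtopology (mtop M) U)
                         (subtopology (Euclidean_space (mdim M)) (\<phi> ` U)) \<phi>) \<and>
     (\<forall>(U, \<phi>) \<in> charts M. \<forall>(V, \<psi>) \<in> charts M. \<forall>j < mdim M.
        smooth_on (mdim M) (\<phi> ` (U \<inter> V)) (\<lambda>x. \<psi> (inv_into U \<phi> x) j))"

text \<open>
  A function on \<open>M\<close> is represented by its extension by \<open>0\<close> off \<^term>\<open>points M\<close>, and an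
  operator on \<open>C\<^sup>\<infinity>(M)\<close> by its extension by \<open>0\<close> to all other functions, so that
  HOL equality is equality of functions, respectively operators, on \<open>M\<close>.
\<close>

definition smooth_functions :: "'a manifold \<Rightarrow> ('a \<Rightarrow> real) set" where
  "smooth_functions M =
     {f. (\<forall>p. p \<notin> points M \<longrightarrow> f p = 0) \<and>
         (\<forall>(U, \<phi>) \<in> charts M. smooth_on (mdim M) (\<phi> ` U) (\<lambda>x. f (inv_into U \<phi> x)))}"

type_synonym 'a vfield = "('a \<Rightarrow> real) \<Rightarrow> 'a \<Rightarrow> real"

text \<open>Vector fields are the derivations of \<open>C\<^sup>\<infinity>(M)\<close>.\<close>

definition vector_fields :: "'a manifold \<Rightarrow> 'a vfield set" where
  "vector_fields M =
     {v. (\<forall>f. f \<notin> smooth_functions M \<longrightarrow> v f = (\<lambda>p. 0)) \<and>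
         (\<forall>f \<in> smooth_functions M. v f \<in> smooth_functions M) \<and>
         (\<forall>f \<in> smooth_functions M. \<forall>g \<in> smooth_functions M.
            v (\<lambda>p. f p + g p) = (\<lambda>p. v f p + v g p) \<and>
            v (\<lambda>p. f p * g p) = (\<lambda>p. f p * v g p + g p * v f p)) \<and>
         (\<forall>f \<in> smooth_functions M. \<forall>c. v (\<lambda>p. c * f p) = (\<lambda>p. c * v f p))}"

definition lie_bracket :: "'a vfield \<Rightarrow> 'a vfield \<Rightarrow> 'a vfield" where
  "lie_bracket u v f = (\<lambda>p. u (v f) p - v (u f) p)"

text \<open>The condition \<open>dz \<noteq> 0\<close> at \<open>p\<close> is expressed through \<open>dz(v) = v(z)\<close>.\<close>

definition zero_set :: "'a manifold \<Rightarrow> ('a \<Rightarrow> real) \<Rightarrow> 'a set" where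
  "zero_set M z = {p \<in> points M. z p = 0}"

definition defining_function :: "'a manifold \<Rightarrow> ('a \<Rightarrow> real) \<Rightarrow> bool" where
  "defining_function M z \<longleftrightarrow>
     z \<in> smooth_functions M \<and>
     (\<forall>p \<in> zero_set M z. \<exists>v \<in> vector_fields M. v z p \<noteq> 0)"

section \<open>\<open>b\<^sup>m\<close>-symplectic geometry\<close>

definition b_fields :: "nat \<Rightarrow> 'a manifold \<Rightarrow> ('a \<Rightarrow> real) \<Rightarrow> 'a vfield set" where
  "b_fields m M z =
     {v \<in> vector_fields M. \<exists>g \<in> smooth_functions M. v z = (\<lambda>p. z p ^ m * g p)}"

text \<open>
  A section of \<open>\<Lambda>\<^sup>2 E\<^sup>*\<close>, where \<open>E\<close> is the bundle whose sections are the
  \<open>b\<^sup>m\<close>-vector fields, is an alternating \<open>C\<^sup>\<infinity>(M)\<close>-bilinear map on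
  sections of \<open>E\<close> with values in \<open>C\<^sup>\<infinity>(M)\<close>.
\<close>

type_synonym 'a form2 = "'a vfield \<Rightarrow> 'a vfield \<Rightarrow> 'a \<Rightarrow> real"

definition b_two_form :: "nat \<Rightarrow> 'a manifold \<Rightarrow> ('a \<Rightarrow> real) \<Rightarrow> 'a form2 \<Rightarrow> bool" where
  "b_two_form m M z \<omega> \<longleftrightarrow>
     (\<forall>u \<in> b_fields m M z. \<omega> u u = (\<lambda>p. 0)) \<and>
     (\<forall>u \<in> b_fields m M z. \<forall>v \<in> b_fields m M z.
        \<omega> u v \<in> smooth_functions M \<and>
        (\<forall>w \<in> b_fields m M z.
           \<omega> (\<lambda>f p. u f p + w f p) v = (\<lambda>p. \<omega> u v p + \<omega> w v p) \<and>
           \<omega> u (\<lambda>f p. v f p + w f p) = (\<lambda>p. \<omega> u v p + \<omega> u w p)) \<and>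
        (\<forall>h \<in> smooth_functions M.
           \<omega> (\<lambda>f p. h p * u f p) v = (\<lambda>p. h p * \<omega> u v p) \<and>
           \<omega> u (\<lambda>f p. h p * v f p) = (\<lambda>p. h p * \<omega> u v p)))"

text \<open>
  The invariant formula for \<open>d\<omega>(u, v, w)\<close>. Since \<open>\<omega>\<close> is evaluated on
  \<open>b\<^sup>m\<close>-vector fields (which are closed under the bracket), it makes sense on all of
  \<open>M\<close>; off \<open>Z\<close> it is the usual exterior derivative, so it is the smooth
  extension of the latter.
\<close>

definition ext_deriv2 ::
    "'a form2 \<Rightarrow> 'a vfield \<Rightarrow> 'a vfield \<Rightarrow> 'a vfield \<Rightarrow> 'a \<Rightarrow> real" where
  "ext_deriv2 \<omega> u v w p =
     u (\<omega> v w) p - v (\<omega> u w) p + w (\<omega> u v) p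
     - \<omega> (lie_bracket u v) w p + \<omega> (lie_bracket u w) v p - \<omega> (lie_bracket v w) u p"

definition closed2 :: "nat \<Rightarrow> 'a manifold \<Rightarrow> ('a \<Rightarrow> real) \<Rightarrow> 'a form2 \<Rightarrow> bool" where
  "closed2 m M z \<omega> \<longleftrightarrow>
     (\<forall>u \<in> b_fields m M z. \<forall>v \<in> b_fields m M z. \<forall>w \<in> b_fields m M z.
        \<forall>p \<in> points M. ext_deriv2 \<omega> u v w p = 0)"

text \<open>The \<open>n\<close>-fold wedge product \<open>\<omega>\<^sup>n\<close>, evaluated on the fields
  \<open>v 0, \<dots>, v (2n - 1)\<close>.\<close>

definition wedge_power :: "nat \<Rightarrow> 'a form2 \<Rightarrow> (nat \<Rightarrow> 'a vfield) \<Rightarrow> 'a \<Rightarrow> real" where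
  "wedge_power n \<omega> v p =
     (\<Sum>\<sigma> | \<sigma> permutes {..<2 * n}.
        of_int (sign \<sigma>) * (\<Prod>i<n. \<omega> (v (\<sigma> (2 * i))) (v (\<sigma> (2 * i + 1))) p)) / 2 ^ n"

text \<open>Every element of the fibre of \<open>E\<close> at \<open>p\<close> is the value of a global
  section, so \<open>\<omega>\<^sup>n\<close> is nonzero at \<open>p\<close> iff it is nonzero at \<open>p\<close> on some
  \<open>2n\<close> global \<open>b\<^sup>m\<close>-vector fields.\<close>

definition b_symplectic_manifold ::
    "nat \<Rightarrow> nat \<Rightarrow> 'a manifold \<Rightarrow> ('a \<Rightarrow> real) \<Rightarrow> 'a form2 \<Rightarrow> bool" where
  "b_symplectic_manifold m n M z \<omega> \<longleftrightarrow>
     smooth_manifold M \<and> mdim M = 2 * n \<and> defining_function M z \<and>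
     b_two_form m M z \<omega> \<and> closed2 m M z \<omega> \<and>
     (\<forall>p \<in> points M. \<exists>v. (\<forall>i < 2 * n. v i \<in> b_fields m M z) \<and> wedge_power n \<omega> v p \<noteq> 0)"

definition is_hamiltonian_field ::
    "nat \<Rightarrow> 'a manifold \<Rightarrow> ('a \<Rightarrow> real) \<Rightarrow> 'a form2 \<Rightarrow> ('a \<Rightarrow> real) \<Rightarrow> 'a vfield \<Rightarrow> bool" where
  "is_hamiltonian_field m M z \<omega> H X \<longleftrightarrow>
     X \<in> b_fields m M z \<and> (\<forall>u \<in> b_fields m M z. \<omega> X u = (\<lambda>p. - u H p))"

text \<open>\<open>\<gamma>'(t) = v(\<gamma>(t))\<close>, tested on all smooth functions.\<close>

definition integral_curve :: "'a manifold \<Rightarrow> 'a vfield \<Rightarrow> (real \<Rightarrow> 'a) \<Rightarrow> bool" where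
  "integral_curve M v \<gamma> \<longleftrightarrow>
     range \<gamma> \<subseteq> points M \<and>
     (\<forall>f \<in> smooth_functions M. \<forall>t.
        ((\<lambda>s. f (\<gamma> s)) has_real_derivative v f (\<gamma> t)) (at t))"

text \<open>Constant orbits count as periodic.\<close>

definition periodic_orbit :: "'a manifold \<Rightarrow> 'a vfield \<Rightarrow> (real \<Rightarrow> 'a) \<Rightarrow> bool" where
  "periodic_orbit M v \<gamma> \<longleftrightarrow> integral_curve M v \<gamma> \<and> (\<exists>T>0. \<forall>t. \<gamma> (t + T) = \<gamma> t)"

end

theory Submission
  imports Defs
begin

text \<open>
  On \<open>\<real>\<^sup>2\<close> with coordinates \<open>x, z\<close> take \<open>\<omega> = dz / z\<^sup>m \<and> dx\<close> and the proper function
  \<open>H = x\<^sup>2 + z\<^sup>2\<close>. Every level set of \<open>H\<close>, including the critical point at the origin, meets the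
  line \<open>Z = {z = 0}\<close>, and the Hamiltonian field vanishes on \<open>Z\<close>; so an orbit off \<open>Z\<close> runs along
  an open half circle and never closes up. In formulas, the Hamiltonian field is
  \<open>X = 2 z\<^sup>m\<^sup>+\<^sup>1 \<partial>\<^sub>x - 2 x z\<^sup>m \<partial>\<^sub>z\<close>, so along an orbit off \<open>Z\<close> the derivative
  \<open>x' = 2 z\<^sup>m\<^sup>+\<^sup>1\<close> is never zero, and by the mean value theorem \<open>x\<close> cannot return to a
  value it has taken (\<open>no_periodic_solution\<close>).

  That \<open>\<omega>\<close> is a closed \<open>b\<^sup>m\<close>-form is pure algebra of derivations. With \<open>\<theta>(u)\<close> the smooth
  function for which \<open>u(z) = z\<^sup>m \<theta>(u)\<close>, so that \<open>\<theta> = dz / z\<^sup>m\<close>, one has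
  \<open>\<omega>(u, v) = \<theta>(u) v(x) - \<theta>(v) u(x)\<close>. The identity
  \<open>\<theta>([u, v]) = u(\<theta>(v)) - v(\<theta>(u))\<close>, which says \<open>d\<theta> = 0\<close>, then makes the invariant formula for
  \<open>d\<omega>\<close> cancel term by term. Likewise \<open>u(H) = 2 x u(x) + 2 z u(z)\<close> follows from the Leibniz rule
  because \<open>H\<close> is a polynomial in the coordinates, so a derivation never has to be expressed through
  partial derivatives.
\<close>

section \<open>Calculus of smooth functions on open sets\<close>

text \<open>Openness of \<open>U\<close> lets partial derivatives be computed from the values of a function on \<open>U\<close>
  alone; this is what makes smoothness on \<open>U\<close> independent of the extension of the function.\<close>

lemma eventually_update_in_open:
  assumes U: "openin (Euclidean_space d) U" and "x \<in> U" "i < d"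
  shows "eventually (\<lambda>t. x(i := t) \<in> U) (nhds (x i))"
proof -
  obtain T where T: "open T" "U = T \<inter> topspace (Euclidean_space d)"
    using U unfolding Euclidean_space_def openin_subtopology
    by (auto simp: euclidean_product_topology)
  have "continuous_on UNIV (\<lambda>t. x(i := t))"
  proof (rule continuous_on_coordinatewise_then_product)
    show "continuous_on UNIV (\<lambda>t. (x(i := t)) j)" for j
      by (cases "j = i") simp_all
  qed
  then have "open ((\<lambda>t. x(i := t)) -` T)"
    using T(1) by (simp add: open_vimage)
  moreover have "x i \<in> (\<lambda>t. x(i := t)) -` T"
    using T(2) \<open>x \<in> U\<close> by simp
  ultimately have "eventually (\<lambda>t. x(i := t) \<in> T) (nhds (x i))"
    by (metis (mono_tags, lifting) eventually_nhds vimageE)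
  moreover have "x(i := t) \<in> topspace (Euclidean_space d)" for t
    using T(2) assms(2,3) by (auto simp: topspace_Euclidean_space)
  ultimately show ?thesis
    by (auto simp: T(2) elim: eventually_mono)
qed

lemma Ck_on_continuous:
  "Ck_on k d U f \<Longrightarrow> continuous_map (subtopology (Euclidean_space d) U) euclideanreal f"
  by (cases k) auto

lemma Ck_on_SucD: "Ck_on (Suc k) d U f \<Longrightarrow> Ck_on k d U f"
  by (induction k arbitrary: f) auto

lemma Ck_on_cong:
  assumes U: "openin (Euclidean_space d) U"
    and eq: "\<And>x. x \<in> U \<Longrightarrow> f x = g x" and f: "Ck_on k d U f"
  shows "Ck_on k d U g"
  using eq f
proof (induction k arbitrary: f g)
  case 0
  then show ?case by (auto intro: continuous_map_eq)
next
  case (Suc k)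
  have ev: "eventually (\<lambda>t. f (x(i := t)) = g (x(i := t))) (nhds (x i))"
    if "x \<in> U" "i < d" for x i
    using eventually_update_in_open[OF U that] by (rule eventually_mono) (rule Suc.prems(1))
  have "continuous_map (subtopology (Euclidean_space d) U) euclideanreal g"
    using Ck_on_continuous[OF Suc.prems(2)] Suc.prems(1) by (auto intro: continuous_map_eq)
  moreover have "(\<lambda>t. g (x(i := t))) differentiable (at (x i))" if "x \<in> U" "i < d" for x i
    using Suc.prems(2) that unfolding Ck_on.simps real_differentiable_def
    by (metis DERIV_cong_ev[OF refl ev[OF that] refl])
  moreover have "Ck_on k d U (partial_deriv i g)" if "i < d" for i
  proof (rule Suc.IH)
    show "partial_deriv i f x = partial_deriv i g x" if "x \<in> U" for x
      unfolding partial_deriv_def using ev[OF that \<open>i < d\<close>] by (rule deriv_cong_ev) simp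
    show "Ck_on k d U (partial_deriv i f)" using Suc.prems(2) that by simp
  qed
  ultimately show ?case by simp
qed

lemma differentiable_slice_has_partial_deriv:
  assumes "(\<lambda>t. f (x(i := t))) differentiable (at (x i))"
  shows "((\<lambda>t. f (x(i := t))) has_real_derivative partial_deriv i f x) (at (x i))"
  using assms by (simp add: partial_deriv_def DERIV_deriv_iff_real_differentiable)

lemma Ck_on_const: "Ck_on k d U (\<lambda>x. c)"
proof (induction k arbitrary: c)
  case (Suc k)
  have "partial_deriv i (\<lambda>x. c) = (\<lambda>x. 0)" for i
    by (auto simp: partial_deriv_def)
  with Suc show ?case by simp
qed simp

lemma partial_deriv_coordinate:
  "partial_deriv i (\<lambda>x. x j) = (\<lambda>x. if i = j then 1 else 0)"
  by (rule ext) (simp add: partial_deriv_def)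

lemma Ck_on_coordinate: "Ck_on k d U (\<lambda>x. x j)"
proof -
  have "continuous_map (subtopology (Euclidean_space d) U) euclideanreal (\<lambda>x. x j)"
    unfolding Euclidean_space_def
    by (intro continuous_map_from_subtopology continuous_map_product_coordinates) simp
  moreover have "(\<lambda>t. (x(i := t)) j) differentiable (at s)" for x :: "nat \<Rightarrow> real" and i s
    by (cases "i = j") simp_all
  ultimately show ?thesis
    by (cases k) (simp_all add: partial_deriv_coordinate Ck_on_const del: fun_upd_apply)
qed

lemma Ck_on_add:
  assumes U: "openin (Euclidean_space d) U" and "Ck_on k d U f" "Ck_on k d U g"
  shows "Ck_on k d U (\<lambda>x. f x + g x)"
  using assms(2,3)
proof (induction k arbitrary: f g)
  case 0
  then show ?case by (simp add: continuous_map_add)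
next
  case (Suc k)
  have D: "((\<lambda>t. f (x(i := t)) + g (x(i := t))) has_real_derivative
      (partial_deriv i f x + partial_deriv i g x)) (at (x i))" if "x \<in> U" "i < d" for x i
    using Suc.prems that by (intro DERIV_add differentiable_slice_has_partial_deriv) auto
  have "Ck_on k d U (partial_deriv i (\<lambda>x. f x + g x))" if "i < d" for i
  proof (rule Ck_on_cong[OF U])
    show "partial_deriv i f x + partial_deriv i g x = partial_deriv i (\<lambda>x. f x + g x) x"
      if "x \<in> U" for x
      using DERIV_imp_deriv[OF D[OF that \<open>i < d\<close>]] by (simp add: partial_deriv_def)
    show "Ck_on k d U (\<lambda>x. partial_deriv i f x + partial_deriv i g x)"
      using Suc.prems \<open>i < d\<close> by (intro Suc.IH) auto
  qed
  moreover have "(\<lambda>t. f (x(i := t)) + g (x(i := t))) differentiable (at (x i))"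
    if "x \<in> U" "i < d" for x i
    using D[OF that] by (auto simp: real_differentiable_def)
  ultimately show ?case
    using Suc.prems by (simp add: continuous_map_add)
qed

lemma Ck_on_mult:
  assumes U: "openin (Euclidean_space d) U" and "Ck_on k d U f" "Ck_on k d U g"
  shows "Ck_on k d U (\<lambda>x. f x * g x)"
  using assms(2,3)
proof (induction k arbitrary: f g)
  case 0
  then show ?case by (simp add: continuous_map_real_mult)
next
  case (Suc k)
  have D: "((\<lambda>t. f (x(i := t)) * g (x(i := t))) has_real_derivative
      (partial_deriv i f x * g x + f x * partial_deriv i g x)) (at (x i))"
    if "x \<in> U" "i < d" for x i
    using DERIV_mult[OF differentiable_slice_has_partial_deriv[of f x i]
        differentiable_slice_has_partial_deriv[of g x i]] Suc.prems that
    by (simp add: algebra_simps)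
  have "Ck_on k d U (partial_deriv i (\<lambda>x. f x * g x))" if "i < d" for i
  proof (rule Ck_on_cong[OF U])
    show "partial_deriv i f x * g x + f x * partial_deriv i g x
        = partial_deriv i (\<lambda>x. f x * g x) x" if "x \<in> U" for x
      using DERIV_imp_deriv[OF D[OF that \<open>i < d\<close>]] by (simp add: partial_deriv_def)
    show "Ck_on k d U (\<lambda>x. partial_deriv i f x * g x + f x * partial_deriv i g x)"
      using Suc.prems Ck_on_SucD[OF Suc.prems(1)] Ck_on_SucD[OF Suc.prems(2)] \<open>i < d\<close>
      by (intro Ck_on_add[OF U] Suc.IH) auto
  qed
  moreover have "(\<lambda>t. f (x(i := t)) * g (x(i := t))) differentiable (at (x i))"
    if "x \<in> U" "i < d" for x i
    using D[OF that] by (auto simp: real_differentiable_def)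
  ultimately show ?case
    using Suc.prems by (simp add: continuous_map_real_mult)
qed

lemma smooth_on_cong:
  assumes "openin (Euclidean_space d) U" "\<And>x. x \<in> U \<Longrightarrow> f x = g x"
  shows "smooth_on d U f \<longleftrightarrow> smooth_on d U g"
  using Ck_on_cong[OF assms(1), of f g] Ck_on_cong[OF assms(1), of g f] assms(2)
  unfolding smooth_on_def by metis

lemma smooth_on_const: "smooth_on d U (\<lambda>x. c)"
  by (simp add: smooth_on_def Ck_on_const)

lemma smooth_on_coordinate: "smooth_on d U (\<lambda>x. x j)"
  by (simp add: smooth_on_def Ck_on_coordinate)

lemma smooth_on_add:
  "openin (Euclidean_space d) U \<Longrightarrow> smooth_on d U f \<Longrightarrow> smooth_on d U g
    \<Longrightarrow> smooth_on d U (\<lambda>x. f x + g x)"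
  by (simp add: smooth_on_def Ck_on_add)

lemma smooth_on_mult:
  "openin (Euclidean_space d) U \<Longrightarrow> smooth_on d U f \<Longrightarrow> smooth_on d U g
    \<Longrightarrow> smooth_on d U (\<lambda>x. f x * g x)"
  by (simp add: smooth_on_def Ck_on_mult)

lemma smooth_on_partial_deriv:
  "smooth_on d U f \<Longrightarrow> i < d \<Longrightarrow> smooth_on d U (partial_deriv i f)"
  unfolding smooth_on_def by (metis Ck_on.simps(2))

lemma smooth_on_slice_has_partial_deriv:
  assumes "smooth_on d U f" "x \<in> U" "i < d"
  shows "((\<lambda>t. f (x(i := t))) has_real_derivative partial_deriv i f x) (at (x i))"
proof (rule differentiable_slice_has_partial_deriv)
  have "Ck_on (Suc 0) d U f" using assms(1) unfolding smooth_on_def by blast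
  then show "(\<lambda>t. f (x(i := t))) differentiable (at (x i))" using assms(2,3) by simp
qed

section \<open>Smooth functions and vector fields on a manifold\<close>

lemma smooth_manifold_chart_image:
  "smooth_manifold M \<Longrightarrow> (U, \<phi>) \<in> charts M \<Longrightarrow> openin (Euclidean_space (mdim M)) (\<phi> ` U)"
  by (auto simp: smooth_manifold_def)

lemma smooth_functions_zero: "(\<lambda>p. 0) \<in> smooth_functions M"
  by (auto simp: smooth_functions_def smooth_on_const)

lemma smooth_functions_add:
  assumes "smooth_manifold M" "f \<in> smooth_functions M" "g \<in> smooth_functions M"
  shows "(\<lambda>p. f p + g p) \<in> smooth_functions M"
  using assms(2,3) smooth_manifold_chart_image[OF assms(1)]
  by (auto simp: smooth_functions_def intro!: smooth_on_add)

lemma smooth_functions_mult: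
  assumes "smooth_manifold M" "f \<in> smooth_functions M" "g \<in> smooth_functions M"
  shows "(\<lambda>p. f p * g p) \<in> smooth_functions M"
  using assms(2,3) smooth_manifold_chart_image[OF assms(1)]
  by (auto simp: smooth_functions_def intro!: smooth_on_mult)

lemma smooth_functions_scale:
  assumes "smooth_manifold M" "f \<in> smooth_functions M"
  shows "(\<lambda>p. c * f p) \<in> smooth_functions M"
  using assms(2) smooth_manifold_chart_image[OF assms(1)]
  by (auto simp: smooth_functions_def intro!: smooth_on_mult smooth_on_const)

lemma smooth_functions_diff:
  assumes "smooth_manifold M" "f \<in> smooth_functions M" "g \<in> smooth_functions M"
  shows "(\<lambda>p. f p - g p) \<in> smooth_functions M"
  using smooth_functions_add[OF assms(1,2) smooth_functions_scale[OF assms(1,3), of "-1"]]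
  by simp

text \<open>The exponent is positive because \<open>f\<^sup>0 = 1\<close> is not zero off the manifold.\<close>

lemma smooth_functions_power_Suc:
  assumes "smooth_manifold M" "f \<in> smooth_functions M"
  shows "(\<lambda>p. f p ^ Suc k) \<in> smooth_functions M"
  by (induction k) (use assms in \<open>auto intro: smooth_functions_mult\<close>)

context
  fixes M :: "'a manifold" and v :: "'a vfield"
  assumes v: "v \<in> vector_fields M"
begin

lemma vector_field_smooth: "f \<in> smooth_functions M \<Longrightarrow> v f \<in> smooth_functions M"
  using v by (simp add: vector_fields_def)

lemma vector_field_add:
  "f \<in> smooth_functions M \<Longrightarrow> g \<in> smooth_functions M \<Longrightarrow>
    v (\<lambda>p. f p + g p) = (\<lambda>p. v f p + v g p)"
  using v by (simp add: vector_fields_def)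

lemma vector_field_mult:
  "f \<in> smooth_functions M \<Longrightarrow> g \<in> smooth_functions M \<Longrightarrow>
    v (\<lambda>p. f p * g p) = (\<lambda>p. f p * v g p + g p * v f p)"
  using v by (simp add: vector_fields_def)

lemma vector_field_scale:
  "f \<in> smooth_functions M \<Longrightarrow> v (\<lambda>p. c * f p) = (\<lambda>p. c * v f p)"
  using v by (simp add: vector_fields_def)

lemma vector_field_diff:
  assumes "smooth_manifold M" "f \<in> smooth_functions M" "g \<in> smooth_functions M"
  shows "v (\<lambda>p. f p - g p) = (\<lambda>p. v f p - v g p)"
  using vector_field_add[OF assms(2) smooth_functions_scale[OF assms(1,3), of "-1"]]
    vector_field_scale[OF assms(3), of "-1"]
  by simp

lemma vector_field_power_Suc:
  assumes "smooth_manifold M" "f \<in> smooth_functions M"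
  shows "v (\<lambda>p. f p ^ Suc k) = (\<lambda>p. real (Suc k) * f p ^ k * v f p)"
proof (induction k)
  case (Suc k)
  have "v (\<lambda>p. f p ^ Suc (Suc k)) = v (\<lambda>p. f p * f p ^ Suc k)" by simp
  also have "\<dots> = (\<lambda>p. f p * v (\<lambda>p. f p ^ Suc k) p + f p ^ Suc k * v f p)"
    using assms by (intro vector_field_mult smooth_functions_power_Suc)
  finally show ?case
    unfolding Suc by (simp add: algebra_simps)
qed simp

end

lemma vector_fields_add:
  assumes "smooth_manifold M" "u \<in> vector_fields M" "v \<in> vector_fields M"
  shows "(\<lambda>f p. u f p + v f p) \<in> vector_fields M"
  using assms(2,3) smooth_functions_add[OF assms(1)]
  unfolding vector_fields_def by (auto simp: fun_eq_iff algebra_simps)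

lemma vector_fields_mult:
  assumes "smooth_manifold M" "h \<in> smooth_functions M" "v \<in> vector_fields M"
  shows "(\<lambda>f p. h p * v f p) \<in> vector_fields M"
proof -
  have "\<forall>f \<in> smooth_functions M. (\<lambda>p. h p * v f p) \<in> smooth_functions M"
    using assms by (auto intro: smooth_functions_mult vector_field_smooth)
  then show ?thesis
    using assms(3) unfolding vector_fields_def by (simp add: fun_eq_iff) (simp add: algebra_simps)
qed

section \<open>The form \<open>dz / z\<^sup>m \<and> dx\<close>\<close>

text \<open>The value of the \<open>b\<^sup>m\<close>-form \<open>dz / z\<^sup>m\<close> on \<open>u\<close> (for \<open>m = 1\<close> this is \<open>d log z\<close>).\<close>

definition dlog_coeff :: "nat \<Rightarrow> 'a manifold \<Rightarrow> ('a \<Rightarrow> real) \<Rightarrow> 'a vfield \<Rightarrow> 'a \<Rightarrow> real" where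
  "dlog_coeff m M z u = (THE g. g \<in> smooth_functions M \<and> u z = (\<lambda>p. z p ^ m * g p))"

definition dlog_wedge_d ::
    "nat \<Rightarrow> 'a manifold \<Rightarrow> ('a \<Rightarrow> real) \<Rightarrow> ('a \<Rightarrow> real) \<Rightarrow> 'a form2" where
  "dlog_wedge_d m M z x u v =
     (\<lambda>p. dlog_coeff m M z u p * v x p - dlog_coeff m M z v p * u x p)"

text \<open>Uniqueness of the quotient by \<open>z\<^sup>m\<close> amounts to density of the complement of the zero set
  of \<open>z\<close>.\<close>

locale b_manifold =
  fixes m :: nat and M :: "'a manifold" and z :: "'a \<Rightarrow> real"
  assumes m: "m \<ge> 1" and M: "smooth_manifold M" and z: "z \<in> smooth_functions M"
    and cancel: "\<And>g h. g \<in> smooth_functions M \<Longrightarrow> h \<in> smooth_functions M \<Longrightarrow>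
      (\<lambda>p. z p ^ m * g p) = (\<lambda>p. z p ^ m * h p) \<Longrightarrow> g = h"
begin

abbreviation "\<theta> \<equiv> dlog_coeff m M z"

lemma dlog_coeff_eqI:
  assumes "g \<in> smooth_functions M" "u z = (\<lambda>p. z p ^ m * g p)"
  shows "\<theta> u = g"
  unfolding dlog_coeff_def
  by (rule the_equality) (use assms in \<open>auto intro: cancel\<close>)

lemma
  assumes "u \<in> b_fields m M z"
  shows dlog_coeff_smooth: "\<theta> u \<in> smooth_functions M"
    and b_field_z: "u z = (\<lambda>p. z p ^ m * \<theta> u p)"
proof -
  obtain g where "g \<in> smooth_functions M" "u z = (\<lambda>p. z p ^ m * g p)"
    using assms by (auto simp: b_fields_def)
  then show "\<theta> u \<in> smooth_functions M" "u z = (\<lambda>p. z p ^ m * \<theta> u p)"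
    using dlog_coeff_eqI[of g u] by simp_all
qed

lemma b_field_vector_field: "u \<in> b_fields m M z \<Longrightarrow> u \<in> vector_fields M"
  by (simp add: b_fields_def)

lemma b_field_smooth:
  "u \<in> b_fields m M z \<Longrightarrow> f \<in> smooth_functions M \<Longrightarrow> u f \<in> smooth_functions M"
  by (rule vector_field_smooth[OF b_field_vector_field])

lemma dlog_coeff_add:
  assumes "u \<in> b_fields m M z" "v \<in> b_fields m M z"
  shows "\<theta> (\<lambda>f p. u f p + v f p) = (\<lambda>p. \<theta> u p + \<theta> v p)"
proof (rule dlog_coeff_eqI)
  show "(\<lambda>p. \<theta> u p + \<theta> v p) \<in> smooth_functions M"
    using assms by (intro smooth_functions_add M dlog_coeff_smooth)
  show "(\<lambda>p. u z p + v z p) = (\<lambda>p. z p ^ m * (\<theta> u p + \<theta> v p))"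
    unfolding b_field_z[OF assms(1)] b_field_z[OF assms(2)] by (simp add: algebra_simps)
qed

lemma dlog_coeff_mult:
  assumes "h \<in> smooth_functions M" "u \<in> b_fields m M z"
  shows "\<theta> (\<lambda>f p. h p * u f p) = (\<lambda>p. h p * \<theta> u p)"
proof (rule dlog_coeff_eqI)
  show "(\<lambda>p. h p * \<theta> u p) \<in> smooth_functions M"
    using assms by (intro smooth_functions_mult M dlog_coeff_smooth)
  show "(\<lambda>p. h p * u z p) = (\<lambda>p. z p ^ m * (h p * \<theta> u p))"
    unfolding b_field_z[OF assms(2)] by (simp add: algebra_simps)
qed

text \<open>This is the closedness of \<open>\<theta> = dz / z\<^sup>m\<close>. In \<open>[u, v] z = u (z\<^sup>m \<theta>(v)) - v (z\<^sup>m \<theta>(u))\<close>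
  the terms in which \<open>z\<^sup>m\<close> is differentiated are
  \<open>m z\<^sup>m\<^sup>-\<^sup>1 z\<^sup>m \<theta>(u) \<theta>(v)\<close> both times, and cancel.\<close>

lemma dlog_coeff_lie_bracket:
  assumes u: "u \<in> b_fields m M z" and v: "v \<in> b_fields m M z"
  shows "\<theta> (lie_bracket u v) = (\<lambda>p. u (\<theta> v) p - v (\<theta> u) p)"
proof (rule dlog_coeff_eqI)
  note uv = b_field_vector_field[OF u] b_field_vector_field[OF v]
  note \<theta> = dlog_coeff_smooth[OF u] dlog_coeff_smooth[OF v]
  show "(\<lambda>p. u (\<theta> v) p - v (\<theta> u) p) \<in> smooth_functions M"
    by (rule smooth_functions_diff[OF M vector_field_smooth[OF uv(1) \<theta>(2)]
          vector_field_smooth[OF uv(2) \<theta>(1)]])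
  obtain k where k: "m = Suc k" using m by (cases m) auto
  have zm: "(\<lambda>p. z p ^ m) \<in> smooth_functions M"
    unfolding k by (intro smooth_functions_power_Suc M z)
  have D: "w (\<lambda>p. z p ^ m * \<theta> w' p) =
      (\<lambda>p. z p ^ m * w (\<theta> w') p + \<theta> w' p * (m * z p ^ k * (z p ^ m * \<theta> w p)))"
    if w: "w \<in> b_fields m M z" and w': "w' \<in> b_fields m M z" for w w'
  proof -
    note W = b_field_vector_field[OF w]
    have "w (\<lambda>p. z p ^ m) = (\<lambda>p. m * z p ^ k * w z p)"
      using vector_field_power_Suc[OF W M z, of k] k by simp
    then show ?thesis
      unfolding vector_field_mult[OF W zm dlog_coeff_smooth[OF w']] b_field_z[OF w] by simp
  qed
  show "lie_bracket u v z = (\<lambda>p. z p ^ m * (u (\<theta> v) p - v (\<theta> u) p))"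
    unfolding lie_bracket_def b_field_z[OF u] b_field_z[OF v] D[OF u v] D[OF v u]
    by (simp add: algebra_simps)
qed

lemma dlog_wedge_d_b_two_form:
  assumes x: "x \<in> smooth_functions M"
  shows "b_two_form m M z (dlog_wedge_d m M z x)"
proof -
  have "dlog_wedge_d m M z x u v \<in> smooth_functions M"
    if "u \<in> b_fields m M z" "v \<in> b_fields m M z" for u v
    unfolding dlog_wedge_d_def
    by (intro smooth_functions_diff smooth_functions_mult M dlog_coeff_smooth
        b_field_smooth[OF that(1) x] b_field_smooth[OF that(2) x] that)
  then show ?thesis
    unfolding b_two_form_def
    by (intro conjI ballI)
      (simp_all add: dlog_wedge_d_def dlog_coeff_add dlog_coeff_mult,
       simp_all add: algebra_simps)
qed

text \<open>\<open>\<theta>\<close> and \<open>dx\<close> are both closed, hence so is their wedge product; on the level of the invariant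
  formula, expanding by the Leibniz rule and the two bracket identities leaves a sum that vanishes
  identically.\<close>

lemma dlog_wedge_d_closed:
  assumes x: "x \<in> smooth_functions M"
  shows "closed2 m M z (dlog_wedge_d m M z x)"
proof -
  have L: "u (dlog_wedge_d m M z x v w) p =
      \<theta> v p * u (w x) p + w x p * u (\<theta> v) p - (\<theta> w p * u (v x) p + v x p * u (\<theta> w) p)"
    if "u \<in> b_fields m M z" "v \<in> b_fields m M z" "w \<in> b_fields m M z" for u v w p
  proof -
    note u = b_field_vector_field[OF that(1)]
    have s: "\<theta> v \<in> smooth_functions M" "\<theta> w \<in> smooth_functions M"
      "v x \<in> smooth_functions M" "w x \<in> smooth_functions M"
      using that x by (simp_all add: dlog_coeff_smooth b_field_smooth)
    show ?thesis
      unfolding dlog_wedge_d_def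
      using s by (simp add: vector_field_diff[OF u M] vector_field_mult[OF u] smooth_functions_mult[OF M])
  qed
  show ?thesis
    unfolding closed2_def ext_deriv2_def
    by (simp add: L) (simp add: dlog_wedge_d_def dlog_coeff_lie_bracket lie_bracket_def algebra_simps)
qed

end

section \<open>Euclidean space as a manifold\<close>

definition Euclidean_manifold :: "nat \<Rightarrow> (nat \<Rightarrow> real) manifold" where
  "Euclidean_manifold d = \<lparr>mdim = d, mtop = Euclidean_space d,
     charts = {(topspace (Euclidean_space d), \<lambda>x. x)}\<rparr>"

lemma Euclidean_manifold_simps [simp]:
  "mdim (Euclidean_manifold d) = d"
  "mtop (Euclidean_manifold d) = Euclidean_space d"
  "charts (Euclidean_manifold d) = {(topspace (Euclidean_space d), \<lambda>x. x)}"
  by (simp_all add: Euclidean_manifold_def)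

lemma update_in_Euclidean_space_iff [simp]:
  "i < d \<Longrightarrow> x(i := t) \<in> topspace (Euclidean_space d) \<longleftrightarrow> x \<in> topspace (Euclidean_space d)"
  by (auto simp: topspace_Euclidean_space)

lemma second_countable_Euclidean_space: "second_countable (Euclidean_space d)"
proof -
  obtain B :: "(nat \<Rightarrow> real) set set" where B: "countable B" "topological_basis B"
    using ex_countable_basis by blast
  have "second_countable (euclidean :: (nat \<Rightarrow> real) topology)"
    unfolding second_countable_def open_openin[symmetric]
    using B by (metis topological_basisE topological_basis_open)
  then show ?thesis
    by (simp add: Euclidean_space_def euclidean_product_topology second_countable_subtopology)
qed

lemma smooth_on_inv_chart:
  "smooth_on d (topspace (Euclidean_space d)) (\<lambda>x. f (inv_into (topspace (Euclidean_space d)) (\<lambda>x. x) x))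
    \<longleftrightarrow> smooth_on d (topspace (Euclidean_space d)) f"
  by (rule smooth_on_cong) (simp_all add: inv_into_f_f[of "\<lambda>x. x", simplified])

lemma smooth_manifold_Euclidean: "smooth_manifold (Euclidean_manifold d)"
proof -
  have "homeomorphic_map (Euclidean_space d) (Euclidean_space d) (\<lambda>x. x)"
    using homeomorphic_map_id[of "Euclidean_space d" "Euclidean_space d"] by (simp add: id_def)
  moreover have "smooth_on d (topspace (Euclidean_space d))
      (\<lambda>x. inv_into (topspace (Euclidean_space d)) (\<lambda>x. x) x j)" for j
    using smooth_on_inv_chart[of d "\<lambda>x. x j"] smooth_on_coordinate by blast
  ultimately show ?thesis
    unfolding smooth_manifold_def
    by (simp add: Hausdorff_Euclidean_space second_countable_Euclidean_space)
qed

lemma smooth_functions_Euclidean_iff: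
  "f \<in> smooth_functions (Euclidean_manifold d) \<longleftrightarrow>
    (\<forall>x. x \<notin> topspace (Euclidean_space d) \<longrightarrow> f x = 0) \<and>
    smooth_on d (topspace (Euclidean_space d)) f"
  unfolding smooth_functions_def using smooth_on_inv_chart[of d f] by simp

lemma smooth_function_has_partial_deriv:
  assumes "f \<in> smooth_functions (Euclidean_manifold d)" "i < d"
  shows "((\<lambda>t. f (x(i := t))) has_real_derivative partial_deriv i f x) (at (x i))"
proof (cases "x \<in> topspace (Euclidean_space d)")
  case True
  then show ?thesis
    using assms by (auto simp: smooth_functions_Euclidean_iff intro: smooth_on_slice_has_partial_deriv)
next
  case False
  then have "(\<lambda>t. f (x(i := t))) = (\<lambda>t. 0)"
    using assms by (auto simp: smooth_functions_Euclidean_iff)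
  then show ?thesis by (simp add: partial_deriv_def)
qed

text \<open>Smooth functions have to vanish off the manifold, which cuts off the coordinate functions and
  the constant \<open>1\<close>.\<close>

definition coord :: "nat \<Rightarrow> nat \<Rightarrow> (nat \<Rightarrow> real) \<Rightarrow> real" where
  "coord d j x = (if x \<in> topspace (Euclidean_space d) then x j else 0)"

definition one_on :: "nat \<Rightarrow> (nat \<Rightarrow> real) \<Rightarrow> real" where
  "one_on d x = (if x \<in> topspace (Euclidean_space d) then 1 else 0)"

definition coord_field :: "nat \<Rightarrow> nat \<Rightarrow> (nat \<Rightarrow> real) vfield" where
  "coord_field d i f =
     (if f \<in> smooth_functions (Euclidean_manifold d) then partial_deriv i f else (\<lambda>x. 0))"

lemma coord_smooth: "coord d j \<in> smooth_functions (Euclidean_manifold d)"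
proof -
  have "smooth_on d (topspace (Euclidean_space d)) (coord d j)
      \<longleftrightarrow> smooth_on d (topspace (Euclidean_space d)) (\<lambda>x. x j)"
    by (rule smooth_on_cong) (auto simp: coord_def)
  then show ?thesis
    by (simp add: smooth_functions_Euclidean_iff smooth_on_coordinate coord_def)
qed

lemma one_on_smooth: "one_on d \<in> smooth_functions (Euclidean_manifold d)"
proof -
  have "smooth_on d (topspace (Euclidean_space d)) (one_on d)
      \<longleftrightarrow> smooth_on d (topspace (Euclidean_space d)) (\<lambda>x. 1)"
    by (rule smooth_on_cong) (auto simp: one_on_def)
  then show ?thesis
    by (simp add: smooth_functions_Euclidean_iff smooth_on_const one_on_def)
qed

lemma coord_field_vector_field:
  assumes i: "i < d"
  shows "coord_field d i \<in> vector_fields (Euclidean_manifold d)"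
proof -
  let ?S = "smooth_functions (Euclidean_manifold d)"
  note M = smooth_manifold_Euclidean[of d]
  note D = smooth_function_has_partial_deriv[OF _ i]
  have "partial_deriv i f \<in> ?S" if f: "f \<in> ?S" for f
  proof -
    have "partial_deriv i f x = 0" if "x \<notin> topspace (Euclidean_space d)" for x
    proof -
      have "(\<lambda>t. f (x(i := t))) = (\<lambda>t. 0)"
        using f that i by (auto simp: smooth_functions_Euclidean_iff)
      then show ?thesis by (simp add: partial_deriv_def)
    qed
    then show ?thesis
      using f i by (simp add: smooth_functions_Euclidean_iff smooth_on_partial_deriv)
  qed
  moreover have "partial_deriv i (\<lambda>p. f p + g p) = (\<lambda>p. partial_deriv i f p + partial_deriv i g p)"
    if "f \<in> ?S" "g \<in> ?S" for f g
    by (rule ext) (subst partial_deriv_def, rule DERIV_imp_deriv, rule DERIV_add[OF D D], fact+)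
  moreover have "partial_deriv i (\<lambda>p. f p * g p)
      = (\<lambda>p. f p * partial_deriv i g p + g p * partial_deriv i f p)"
    if "f \<in> ?S" "g \<in> ?S" for f g
  proof
    fix x
    show "partial_deriv i (\<lambda>p. f p * g p) x = f x * partial_deriv i g x + g x * partial_deriv i f x"
      unfolding partial_deriv_def[of i "\<lambda>p. f p * g p"]
      using DERIV_mult[OF D[OF that(1), of x] D[OF that(2), of x]]
      by (intro DERIV_imp_deriv) (simp add: algebra_simps)
  qed
  moreover have "partial_deriv i (\<lambda>p. c * f p) = (\<lambda>p. c * partial_deriv i f p)"
    if "f \<in> ?S" for f c
    by (rule ext) (subst partial_deriv_def, rule DERIV_imp_deriv, rule DERIV_cmult[OF D], fact)
  ultimately show ?thesis
    using smooth_functions_add[OF M] smooth_functions_mult[OF M] smooth_functions_scale[OF M]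
    by (simp add: vector_fields_def coord_field_def)
qed

lemma coord_field_coord:
  assumes "i < d"
  shows "coord_field d i (coord d j) = (if i = j then one_on d else (\<lambda>x. 0))"
proof
  fix x
  have "(\<lambda>t. coord d j (x(i := t)))
      = (if x \<in> topspace (Euclidean_space d) then (if i = j then (\<lambda>t. t) else (\<lambda>t. x j)) else (\<lambda>t. 0))"
    using assms by (auto simp: coord_def)
  then show "coord_field d i (coord d j) x = (if i = j then one_on d else (\<lambda>x. 0)) x"
    by (simp add: coord_field_def coord_smooth partial_deriv_def one_on_def)
qed

text \<open>Off the hyperplane the power can be divided out; at a point of the hyperplane both functions
  are limits of their values along the \<open>j\<close>-th coordinate line, where they already agree.\<close>

lemma coord_power_cancel:
  assumes j: "j < d"
    and g: "g \<in> smooth_functions (Euclidean_manifold d)"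
    and h: "h \<in> smooth_functions (Euclidean_manifold d)"
    and eq: "(\<lambda>x. coord d j x ^ m * g x) = (\<lambda>x. coord d j x ^ m * h x)"
  shows "g = h"
proof
  fix x
  show "g x = h x"
  proof (cases "x \<in> topspace (Euclidean_space d)")
    case False
    then show ?thesis using g h by (simp add: smooth_functions_Euclidean_iff)
  next
    case True
    have ne: "g (x(j := t)) = h (x(j := t))" if "t \<noteq> 0" for t
      using fun_cong[OF eq, of "x(j := t)"] that True j by (simp add: coord_def)
    show ?thesis
    proof (cases "x j = 0")
      case False
      then show ?thesis using ne[of "x j"] by simp
    next
      case x0: True
      have lim: "(\<lambda>t. f (x(j := t))) \<midarrow>0\<rightarrow> f x" if "f \<in> smooth_functions (Euclidean_manifold d)" for f
        using DERIV_isCont[OF smooth_function_has_partial_deriv[OF that j, of x]] x0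
        by (simp add: isCont_def fun_upd_idem)
      have "(\<lambda>t. g (x(j := t))) \<midarrow>0\<rightarrow> h x"
        using lim[OF h] by (rule Lim_transform_eventually) (simp add: ne eventually_at_filter)
      with lim[OF g] show ?thesis by (rule LIM_unique)
    qed
  qed
qed

lemma b_manifold_Euclidean:
  "m \<ge> 1 \<Longrightarrow> j < d \<Longrightarrow> b_manifold m (Euclidean_manifold d) (coord d j)"
  by unfold_locales (assumption | rule smooth_manifold_Euclidean coord_smooth coord_power_cancel)+

section \<open>The example in the plane\<close>

definition radius_sq :: "(nat \<Rightarrow> real) \<Rightarrow> real" where
  "radius_sq p = coord 2 0 p * coord 2 0 p + coord 2 1 p * coord 2 1 p"

text \<open>The preimage of a compact set is closed and lies in a cube, which is compact by Tychonoff's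
  theorem.\<close>

lemma proper_map_radius_sq: "proper_map (Euclidean_space 2) euclideanreal radius_sq"
proof (rule compact_imp_proper_map)
  let ?E = "topspace (Euclidean_space 2)"
  have r: "radius_sq p = (p 0)\<^sup>2 + (p 1)\<^sup>2" if "p \<in> ?E" for p
    using that by (simp add: radius_sq_def coord_def power2_eq_square)
  have cont: "continuous_map (Euclidean_space 2) euclideanreal radius_sq"
  proof (rule continuous_map_eq)
    show "continuous_map (Euclidean_space 2) euclideanreal (\<lambda>p. (p 0)\<^sup>2 + (p 1)\<^sup>2)"
      unfolding Euclidean_space_def euclidean_product_topology continuous_map_iff_continuous
      by (intro continuous_intros continuous_on_product_coordinates[THEN continuous_on_subset]) simp_all
  qed (simp add: r)
  then show "continuous_map (Euclidean_space 2) euclideanreal radius_sq \<or> kc_space (Euclidean_space 2)" ..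
  show "radius_sq \<in> ?E \<rightarrow> topspace euclideanreal" by simp
  show "compactin (Euclidean_space 2) {p \<in> ?E. radius_sq p \<in> K}" if K: "compactin euclideanreal K" for K
  proof -
    from K have "compact K" by simp
    then obtain c where c: "\<And>k. k \<in> K \<Longrightarrow> \<bar>k\<bar> \<le> c"
      using compact_imp_bounded[of K] unfolding bounded_real by blast
    \<comment> \<open>\<open>\<bar>c\<bar> + 1\<close> dominates the square root of \<open>c\<close>, because \<open>\<bar>c\<bar> \<le> (\<bar>c\<bar> + 1)\<^sup>2\<close>.\<close>
    define B where "B = (\<Pi>\<^sub>E i\<in>UNIV. if i < (2::nat) then {-(\<bar>c\<bar>+1)..\<bar>c\<bar>+1} else {0::real})"
    have "compactin (powertop_real UNIV) B"
      unfolding B_def compactin_PiE by simp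
    moreover have "B \<subseteq> {p. \<forall>i\<ge>2. p i = 0}"
    proof clarify
      fix p :: "nat \<Rightarrow> real" and i :: nat
      assume "p \<in> B" "2 \<le> i"
      then have "p i \<in> (if i < 2 then {-(\<bar>c\<bar>+1)..\<bar>c\<bar>+1} else {0})"
        unfolding B_def by blast
      with \<open>2 \<le> i\<close> show "p i = 0" by simp
    qed
    ultimately have B: "compactin (Euclidean_space 2) B"
      by (simp add: Euclidean_space_def compactin_subtopology)
    have "closedin (Euclidean_space 2) {p \<in> ?E. radius_sq p \<in> K}"
      using \<open>compact K\<close> by (intro closedin_continuous_map_preimage[OF cont]) (simp add: compact_imp_closed)
    moreover have "{p \<in> ?E. radius_sq p \<in> K} \<subseteq> B"
    proof clarify
      fix p assume p: "p \<in> ?E" "radius_sq p \<in> K"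
      have "(p 0)\<^sup>2 + (p 1)\<^sup>2 \<le> \<bar>c\<bar>"
        using c[OF p(2)] r[OF p(1)] by linarith
      moreover have "0 \<le> (p 0)\<^sup>2" "0 \<le> (p 1)\<^sup>2" by simp_all
      moreover have "\<bar>c\<bar> \<le> (\<bar>c\<bar> + 1)\<^sup>2"
        unfolding power2_sum power_one mult_1_right using zero_le_power2[of "\<bar>c\<bar>"] abs_ge_zero[of c] by linarith
      ultimately have "(p 0)\<^sup>2 \<le> (\<bar>c\<bar> + 1)\<^sup>2" "(p 1)\<^sup>2 \<le> (\<bar>c\<bar> + 1)\<^sup>2"
        by linarith+
      then have bound: "\<bar>p 0\<bar> \<le> \<bar>c\<bar> + 1" "\<bar>p 1\<bar> \<le> \<bar>c\<bar> + 1"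
        by (simp_all add: power2_le_iff_abs_le)
      have "p i \<in> (if i < 2 then {-(\<bar>c\<bar>+1)..\<bar>c\<bar>+1} else {0})" for i
      proof (cases "i < 2")
        case True
        then have "i = 0 \<or> i = 1" by linarith
        with bound have "\<bar>p i\<bar> \<le> \<bar>c\<bar> + 1" by blast
        with True show ?thesis unfolding abs_le_iff by simp
      next
        case False
        with p(1) show ?thesis by (simp add: topspace_Euclidean_space)
      qed
      then show "p \<in> B" unfolding B_def by blast
    qed
    ultimately show ?thesis
      by (intro closed_compactin[OF B])
  qed
qed (rule k_space_euclideanreal kc_space_euclidean)+

lemma permutes_two: "{\<sigma>. \<sigma> permutes {..<2 * 1 :: nat}} = {id, Transposition.transpose 0 1}"
proof -
  have two: "{..<2 * 1 :: nat} = {0, 1}" by auto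
  show ?thesis
    unfolding two permutes_doubleton_iff by blast
qed

lemma wedge_power_one:
  assumes "\<omega> (v 1) (v 0) p = - \<omega> (v 0) (v 1) p"
  shows "wedge_power 1 \<omega> v p = \<omega> (v 0) (v 1) p"
proof -
  have "id \<noteq> Transposition.transpose (0::nat) 1" by (metis id_apply transpose_apply_first zero_neq_one)
  then show ?thesis
    using assms unfolding wedge_power_def permutes_two by (simp add: sign_swap_id)
qed

lemma no_periodic_solution:
  fixes a b :: "real \<Rightarrow> real"
  assumes a': "\<And>t. (a has_real_derivative 2 * b t ^ k) (at t)"
    and b: "\<And>t. b t \<noteq> 0" and T: "T > 0" and per: "a T = a 0"
  shows False
proof -
  obtain t where "a T - a 0 = (T - 0) * (2 * b t ^ k)"
    using MVT2[OF T, of a "\<lambda>t. 2 * b t ^ k"] a' by blast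
  with b T per show False by simp
qed

theorem claim6p9:
  fixes m :: nat
  assumes "m \<ge> 1"
  shows "\<exists>n (W :: (nat \<Rightarrow> real) manifold) z \<omega> H X.
           b_symplectic_manifold m n W z \<omega> \<and> zero_set W z \<noteq> {} \<and>
           H \<in> smooth_functions W \<and> proper_map (mtop W) euclideanreal H \<and>
           is_hamiltonian_field m W z \<omega> H X \<and>
           \<not> (\<exists>\<gamma>. periodic_orbit W X \<gamma> \<and> range \<gamma> \<subseteq> points W - zero_set W z)"
proof -
  define W where "W = Euclidean_manifold 2"
  define z where "z = coord 2 1"
  define x where "x = coord 2 0"
  define \<omega> where "\<omega> = dlog_wedge_d m W z x"
  define Dx where "Dx = coord_field 2 0"
  define Dz where "Dz = coord_field 2 1"
  \<comment> \<open>\<open>\<iota>\<^sub>X \<omega> = \<theta>(X) dx - dx(X) \<theta>\<close> has to be \<open>- 2 x dx - 2 z dz = - 2 x dx - 2 z\<^sup>m\<^sup>+\<^sup>1 \<theta>\<close>, where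
    \<open>\<theta> = dz / z\<^sup>m\<close>; hence \<open>\<theta>(X) = - 2 x\<close> and \<open>dx(X) = 2 z\<^sup>m\<^sup>+\<^sup>1\<close>.\<close>
  define X where
    "X = (\<lambda>f p. (2 * z p ^ Suc m) * Dx f p + (- 2 * (z p ^ m * x p)) * Dz f p)"
  have M: "smooth_manifold W" and x: "x \<in> smooth_functions W" and z: "z \<in> smooth_functions W"
    unfolding W_def x_def z_def by (rule smooth_manifold_Euclidean coord_smooth)+
  interpret b_manifold m W z
    unfolding W_def z_def using assms by (rule b_manifold_Euclidean) simp
  have Dx_field: "Dx \<in> vector_fields W" and Dz_field: "Dz \<in> vector_fields W"
    unfolding W_def Dx_def Dz_def by (simp_all add: coord_field_vector_field)
  have Dxx: "Dx x = one_on 2" and Dxz: "Dx z = (\<lambda>p. 0)"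
    and Dzx: "Dz x = (\<lambda>p. 0)" and Dzz: "Dz z = one_on 2"
    by (simp_all add: Dx_def Dz_def x_def z_def coord_field_coord)
  have one: "one_on 2 \<in> smooth_functions W"
    unfolding W_def by (rule one_on_smooth)
  have zm: "(\<lambda>p. z p ^ Suc k) \<in> smooth_functions W" for k
    using M z by (rule smooth_functions_power_Suc)
  have zm': "(\<lambda>p. z p ^ m) \<in> smooth_functions W"
    using zm[of "m - 1"] assms by simp

  define zDz where "zDz = (\<lambda>f p. z p ^ m * Dz f p)"
  have bDx: "Dx \<in> b_fields m W z"
    unfolding b_fields_def
    using Dx_field Dxz by (auto intro!: bexI[of _ "\<lambda>p. 0"] smooth_functions_zero)
  have bDz: "zDz \<in> b_fields m W z"
    unfolding b_fields_def
    using vector_fields_mult[OF M zm' Dz_field] one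
    by (auto simp: zDz_def Dzz intro!: bexI[of _ "one_on 2"])
  have c: "\<theta> Dx = (\<lambda>p. 0)" "\<theta> zDz = one_on 2"
    by (rule dlog_coeff_eqI; simp add: zDz_def Dxz Dzz one smooth_functions_zero)+
  have zDzx: "zDz x = (\<lambda>p. 0)"
    by (simp add: zDz_def Dzx)
  have "wedge_power 1 \<omega> (\<lambda>i. if i = 0 then zDz else Dx) p \<noteq> 0" if "p \<in> points W" for p
  proof -
    have "one_on 2 p = 1" using that by (simp add: W_def one_on_def)
    then show ?thesis
      by (subst wedge_power_one) (simp_all add: \<omega>_def dlog_wedge_d_def c Dxx zDzx)
  qed
  then have "\<forall>p \<in> points W. \<exists>v. (\<forall>i < 2 * 1. v i \<in> b_fields m W z) \<and> wedge_power 1 \<omega> v p \<noteq> 0"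
    using bDx bDz by (intro ballI exI[of _ "\<lambda>i. if i = 0 then zDz else Dx"]) simp
  moreover have "defining_function W z"
    unfolding defining_function_def zero_set_def
    using z Dz_field by (auto intro!: bexI[of _ Dz] simp: Dzz one_on_def W_def)
  ultimately have symp: "b_symplectic_manifold m 1 W z \<omega>"
    using M dlog_wedge_d_b_two_form[OF x] dlog_wedge_d_closed[OF x]
    by (simp add: b_symplectic_manifold_def \<omega>_def W_def)

  have H: "radius_sq \<in> smooth_functions W"
    using smooth_functions_add[OF M smooth_functions_mult[OF M x x] smooth_functions_mult[OF M z z]]
    by (simp add: radius_sq_def[abs_def] x_def z_def)

  have "X \<in> vector_fields W"
    unfolding X_def
    by (rule vector_fields_add[OF M vector_fields_mult[OF M _ Dx_field] vector_fields_mult[OF M _ Dz_field]];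
        rule smooth_functions_scale[OF M]; rule zm smooth_functions_mult[OF M zm' x])
  have Xx: "X x = (\<lambda>p. 2 * z p ^ Suc m)"
    unfolding X_def Dxx Dzx by (auto simp: z_def one_on_def coord_def)
  have Xz: "X z = (\<lambda>p. z p ^ m * (- 2 * x p))"
    unfolding X_def Dxz Dzz by (auto simp: x_def one_on_def coord_def)
  have bX: "X \<in> b_fields m W z"
    unfolding b_fields_def using \<open>X \<in> vector_fields W\<close> Xz
    by (auto intro!: bexI[of _ "\<lambda>p. - 2 * x p"] smooth_functions_scale[OF M x])
  have \<theta>X: "\<theta> X = (\<lambda>p. - 2 * x p)"
    using smooth_functions_scale[OF M x] Xz by (rule dlog_coeff_eqI)
  have ham: "is_hamiltonian_field m W z \<omega> radius_sq X"
    unfolding is_hamiltonian_field_def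
  proof (intro conjI bX ballI)
    fix u assume u: "u \<in> b_fields m W z"
    note uv = b_field_vector_field[OF u]
    have "u radius_sq = (\<lambda>p. (x p * u x p + x p * u x p) + (z p * u z p + z p * u z p))"
      unfolding radius_sq_def[abs_def] x_def[symmetric] z_def[symmetric]
      using M x z by (simp add: vector_field_add[OF uv] vector_field_mult[OF uv] smooth_functions_mult)
    then show "\<omega> X u = (\<lambda>p. - u radius_sq p)"
      by (simp add: \<omega>_def dlog_wedge_d_def \<theta>X Xx b_field_z[OF u] algebra_simps)
  qed

  have no_orbit: "\<not> (\<exists>\<gamma>. periodic_orbit W X \<gamma> \<and> range \<gamma> \<subseteq> points W - zero_set W z)"
  proof clarify
    fix \<gamma> assume "periodic_orbit W X \<gamma>" and off: "range \<gamma> \<subseteq> points W - zero_set W z"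
    then obtain T where curve: "integral_curve W X \<gamma>" and T: "T > 0" "\<And>t. \<gamma> (t + T) = \<gamma> t"
      unfolding periodic_orbit_def by blast
    have D: "((\<lambda>s. x (\<gamma> s)) has_real_derivative 2 * z (\<gamma> t) ^ Suc m) (at t)" for t
    proof -
      have "((\<lambda>s. x (\<gamma> s)) has_real_derivative X x (\<gamma> t)) (at t)"
        using curve unfolding integral_curve_def by (elim conjE) (drule bspec[OF _ x], erule spec)
      then show ?thesis unfolding Xx .
    qed
    have "z (\<gamma> t) \<noteq> 0" for t
      using off by (auto simp: zero_set_def)
    moreover have "x (\<gamma> T) = x (\<gamma> 0)" using T(2)[of 0] by simp
    ultimately show False
      by (rule no_periodic_solution[OF D _ T(1)])
  qed

  have "(\<lambda>i. 0) \<in> zero_set W z"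
    by (simp add: zero_set_def W_def z_def coord_def topspace_Euclidean_space)
  then have nonempty: "zero_set W z \<noteq> {}" by blast
  have proper: "proper_map (mtop W) euclideanreal radius_sq"
    by (simp add: W_def proper_map_radius_sq)
  show ?thesis
    by (rule exI[of _ 1], rule exI[of _ W], rule exI[of _ z], rule exI[of _ \<omega>],
        rule exI[of _ radius_sq], rule exI[of _ X])
      (intro conjI symp nonempty H proper ham no_orbit)
qed

end
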